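(* Let $S$ be a right reversible compact semitopological semigroup, and let $K$ be a subset of a locally convex space $(X,Q)$. Then every separately continuous and asymptotically separately $Q$-nonexpansive action of $S$ on $K$ is super asymptotically separately $Q$-nonexpansive. Likewise, every separately continuous and asymptotically uniformly $Q$-nonexpansive action of $S$ on $K$ is super asymptotically uniformly $Q$-nonexpansive.
   Context: A semitopological semigroup is a semigroup $S$ with a Hausdorff topology such that for each fixed $t\in S$ the maps $s\mapsto ts$ and $s\mapsto st$ are continuous. A left ideal is a nonempty subset $I\subseteq S$ with $SI\subseteq I$. $S$ is right reversible if any two closed left ideals of $S$ intersect. $(X,Q)$ denotes a (Hausdorff) locally convex space $X$ together with a selected family $Q$ of seminorms defining its topology. An action of $S$ on $K$ is a map $S\times K\to K$, $(s,x)\mapsto s.x$, with $(st).x=s.(t.x)$; it is separately continuous if this map is separately continuous. The action is: - asymptotically uniformly $Q$-nonexpansive if for all $x,y\in K$ there is a left ideal $I_{xy}$ of $S$ such that $q(s.x-s.y)\le q(x-y)$ for all $s\in I_{xy}$ and all $q\in Q$; - asymptotically separately $Q$-nonexpansive if for all $x,y\in K$ and $q\in Q$ there is a left ideal $I^q_{xy}$ of $S$ such that $q(s.x-s.y)\le q(x-y)$ for all $s\in I^q_{xy}$; - super asymptotically uniformly $Q$-nonexpansive if for all $x\in K$ and $t\in S$ there is a left ideal $I_x^t$ of $S$ such that $q(st.x-st.y)\le q(x-y)$ for all $s\in I_x^t$, all $y\in K$ and all $q\in Q$; - super asymptotically separately $Q$-nonexpansive if for all $x\in K$, $t\in S$,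 $q\in Q$ there is a left ideal $I_x^{q,t}$ of $S$ such that $q(st.x-st.y)\le q(x-y)$ for all $s\in I_x^{q,t}$ and all $y\in K$. *)

theory Defs
  imports "HOL-Analysis.Analysis"
begin

text \<open>Multiplication is only separately continuous, unlike in the library class
  \<open>topological_semigroup_mult\<close>, where it is jointly continuous.\<close>

class semitopological_semigroup = semigroup_mult + t2_space +
  assumes open_vimage_left_mult: "open U \<Longrightarrow> open ((\<lambda>s. t * s) -` U)"
    and open_vimage_right_mult: "open U \<Longrightarrow> open ((\<lambda>s. s * t) -` U)"

lemma continuous_on_left_mult: "continuous_on UNIV (\<lambda>s::'s::semitopological_semigroup. t * s)"
  by (simp add: continuous_on_open_vimage open_vimage_left_mult)

lemma continuous_on_right_mult: "continuous_on UNIV (\<lambda>s::'s::semitopological_semigroup. s * t)"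
  by (simp add: continuous_on_open_vimage open_vimage_right_mult)

definition left_ideal :: "'s::semigroup_mult set \<Rightarrow> bool" where
  "left_ideal I \<longleftrightarrow> I \<noteq> {} \<and> (\<forall>s. \<forall>i\<in>I. s * i \<in> I)"

definition right_reversible :: "'s::semitopological_semigroup itself \<Rightarrow> bool" where
  "right_reversible _ \<longleftrightarrow>
    (\<forall>I J :: 's set. left_ideal I \<and> closed I \<and> left_ideal J \<and> closed J \<longrightarrow> I \<inter> J \<noteq> {})"

definition seminorm :: "('x::real_vector \<Rightarrow> real) \<Rightarrow> bool" where
  "seminorm q \<longleftrightarrow> (\<forall>x. 0 \<le> q x) \<and> (\<forall>x y. q (x + y) \<le> q x + q y)
    \<and> (\<forall>c x. q (c *\<^sub>R x) = \<bar>c\<bar> * q x)"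

text \<open>The Hausdorff requirement is the sort constraint \<open>t2_space\<close>. The topology is the coarsest
  one in which all translates of open seminorm balls are open.\<close>

definition locally_convex_space :: "('x::{real_vector,t2_space} \<Rightarrow> real) set \<Rightarrow> bool" where
  "locally_convex_space Q \<longleftrightarrow> (\<forall>q\<in>Q. seminorm q)
    \<and> (open :: 'x set \<Rightarrow> bool) = generate_topology {{y. q (y - x) < e} | q x e. q \<in> Q \<and> 0 < e}"

text \<open>Actions are total functions; only their values on \<open>K\<close> are constrained.\<close>

definition action_on :: "'x set \<Rightarrow> ('s::semigroup_mult \<Rightarrow> 'x \<Rightarrow> 'x) \<Rightarrow> bool" where
  "action_on K act \<longleftrightarrow> (\<forall>s. \<forall>x\<in>K. act s x \<in> K)
    \<and> (\<forall>s t. \<forall>x\<in>K. act (s * t) x = act s (act t x))"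

definition separately_continuous_on ::
  "'x::topological_space set \<Rightarrow> ('s::topological_space \<Rightarrow> 'x \<Rightarrow> 'x) \<Rightarrow> bool" where
  "separately_continuous_on K act \<longleftrightarrow> (\<forall>s. continuous_on K (\<lambda>x. act s x))
    \<and> (\<forall>x\<in>K. continuous_on UNIV (\<lambda>s. act s x))"

definition asymp_uniformly_nonexpansive ::
  "('x::real_vector \<Rightarrow> real) set \<Rightarrow> 'x set \<Rightarrow> ('s::semigroup_mult \<Rightarrow> 'x \<Rightarrow> 'x) \<Rightarrow> bool" where
  "asymp_uniformly_nonexpansive Q K act \<longleftrightarrow>
    (\<forall>x\<in>K. \<forall>y\<in>K. \<exists>I. left_ideal I \<and>
      (\<forall>s\<in>I. \<forall>q\<in>Q. q (act s x - act s y) \<le> q (x - y)))"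

definition asymp_separately_nonexpansive ::
  "('x::real_vector \<Rightarrow> real) set \<Rightarrow> 'x set \<Rightarrow> ('s::semigroup_mult \<Rightarrow> 'x \<Rightarrow> 'x) \<Rightarrow> bool" where
  "asymp_separately_nonexpansive Q K act \<longleftrightarrow>
    (\<forall>x\<in>K. \<forall>y\<in>K. \<forall>q\<in>Q. \<exists>I. left_ideal I \<and>
      (\<forall>s\<in>I. q (act s x - act s y) \<le> q (x - y)))"

definition super_asymp_uniformly_nonexpansive ::
  "('x::real_vector \<Rightarrow> real) set \<Rightarrow> 'x set \<Rightarrow> ('s::semigroup_mult \<Rightarrow> 'x \<Rightarrow> 'x) \<Rightarrow> bool" where
  "super_asymp_uniformly_nonexpansive Q K act \<longleftrightarrow>
    (\<forall>x\<in>K. \<forall>t. \<exists>I. left_ideal I \<and>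
      (\<forall>s\<in>I. \<forall>y\<in>K. \<forall>q\<in>Q. q (act (s * t) x - act (s * t) y) \<le> q (x - y)))"

definition super_asymp_separately_nonexpansive ::
  "('x::real_vector \<Rightarrow> real) set \<Rightarrow> 'x set \<Rightarrow> ('s::semigroup_mult \<Rightarrow> 'x \<Rightarrow> 'x) \<Rightarrow> bool" where
  "super_asymp_separately_nonexpansive Q K act \<longleftrightarrow>
    (\<forall>x\<in>K. \<forall>t. \<forall>q\<in>Q. \<exists>I. left_ideal I \<and>
      (\<forall>s\<in>I. \<forall>y\<in>K. q (act (s * t) x - act (s * t) y) \<le> q (x - y)))"

end

theory Submission
  imports Defs
begin

text \<open>Every left ideal contains a principal one \<open>S s\<close>, which is closed because \<open>S\<close> is compact. By right
  reversibility and compactness, the closed left ideals have a common point, so their intersection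
  \<open>L\<close> is a least left ideal. Hence the nonexpansiveness inequalities hold on \<open>L\<close> for all points
  simultaneously. Leastness makes \<open>L\<close> also a right ideal, so \<open>s t \<in> L\<close> whenever \<open>s \<in> L\<close>, and \<open>L\<close>
  witnesses the super version.\<close>

lemma left_ideal_range_mult: "left_ideal (range (\<lambda>u. u * s))"
  unfolding left_ideal_def by (auto simp flip: mult.assoc)

text \<open>The set is the image of a compact space under a continuous right translation, hence
  compact, hence closed in a Hausdorff space.\<close>

lemma closed_range_mult:
  fixes s :: "'s::semitopological_semigroup"
  assumes "compact (UNIV :: 's set)"
  shows "closed (range (\<lambda>u. u * s))"
  by (intro compact_imp_closed compact_continuous_image continuous_on_right_mult assms)

lemma range_mult_subset_left_ideal:
  assumes "left_ideal I" "s \<in> I"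
  shows "range (\<lambda>u. u * s) \<subseteq> I"
  using assms unfolding left_ideal_def by auto

lemma left_ideal_Inter:
  assumes "\<And>I. I \<in> \<F> \<Longrightarrow> left_ideal I" and "\<Inter>\<F> \<noteq> {}"
  shows "left_ideal (\<Inter>\<F>)"
  using assms unfolding left_ideal_def by blast

lemma left_ideal_finite_Inter:
  fixes \<F> :: "'s::semitopological_semigroup set set"
  assumes rev: "right_reversible TYPE('s)" and "finite \<F>"
    and "\<And>I. I \<in> \<F> \<Longrightarrow> left_ideal I \<and> closed I"
  shows "left_ideal (\<Inter>\<F>)"
  using assms(2,3)
proof (induction \<F> rule: finite_induct)
  case empty
  show ?case by (simp add: left_ideal_def)
next
  case (insert J \<F>)
  \<comment> \<open>Closedness is carried along because right reversibility speaks only of closed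
    left ideals; it makes this intersection meet \<open>J\<close>.\<close>
  have "left_ideal (\<Inter>\<F>)" "closed (\<Inter>\<F>)"
    using insert by auto
  then have "\<Inter>(insert J \<F>) \<noteq> {}"
    using rev insert.prems[of J] unfolding right_reversible_def by simp
  then show ?case
    using insert.prems by (intro left_ideal_Inter) blast+
qed

lemma least_left_ideal_exists:
  assumes compact: "compact (UNIV :: 's::semitopological_semigroup set)"
    and rev: "right_reversible TYPE('s::semitopological_semigroup)"
  obtains L :: "'s::semitopological_semigroup set"
    where "left_ideal L" "\<And>I. left_ideal I \<Longrightarrow> L \<subseteq> I"
proof
  let ?\<F> = "{I :: 's set. left_ideal I \<and> closed I}"
  have "UNIV \<inter> \<Inter>?\<F> \<noteq> {}"
  proof (rule compact_imp_fip[OF compact])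
    fix \<G> assume "finite \<G>" "\<G> \<subseteq> ?\<F>"
    then have "left_ideal (\<Inter>\<G>)"
      by (intro left_ideal_finite_Inter[OF rev]) auto
    then show "UNIV \<inter> \<Inter>\<G> \<noteq> {}"
      by (simp add: left_ideal_def)
  qed simp
  then show "left_ideal (\<Inter>?\<F>)"
    by (intro left_ideal_Inter) auto
  fix I :: "'s set" assume I: "left_ideal I"
  then obtain s where s: "s \<in> I"
    by (auto simp: left_ideal_def)
  \<comment> \<open>\<open>I\<close> may fail to be closed and so lie outside \<open>?\<F>\<close>;
    the principal left ideal inside it is a member.\<close>
  have "\<Inter>?\<F> \<subseteq> range (\<lambda>u. u * s)"
    using left_ideal_range_mult closed_range_mult[OF compact] by (intro Inter_lower) simp
  also have "\<dots> \<subseteq> I"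
    using I s by (rule range_mult_subset_left_ideal)
  finally show "\<Inter>?\<F> \<subseteq> I" .
qed

text \<open>The set \<open>{s \<in> L. s t \<in> L}\<close> is a left ideal, nonempty because \<open>L t\<close> is a left ideal and thus
  contains \<open>L\<close>.\<close>

lemma least_left_ideal_mult_right:
  assumes L: "left_ideal L" and least: "\<And>I. left_ideal I \<Longrightarrow> L \<subseteq> I" and "s \<in> L"
  shows "s * t \<in> L"
proof -
  have "left_ideal ((\<lambda>u. u * t) ` L)"
    using L unfolding left_ideal_def by (auto simp flip: mult.assoc)
  then have "L \<subseteq> (\<lambda>u. u * t) ` L"
    by (rule least)
  then have "left_ideal {u \<in> L. u * t \<in> L}"
    using L unfolding left_ideal_def by (auto simp: mult.assoc)
  then show ?thesis
    using least \<open>s \<in> L\<close> by blast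
qed

theorem proposition3p7:
  fixes Q :: "('x::{real_vector,t2_space} \<Rightarrow> real) set"
    and K :: "'x set"
  assumes "compact (UNIV :: 's::semitopological_semigroup set)"
    and "right_reversible TYPE('s)"
    and "locally_convex_space Q"
  shows "(\<forall>act :: 's \<Rightarrow> 'x \<Rightarrow> 'x.
            action_on K act \<and> separately_continuous_on K act
              \<and> asymp_separately_nonexpansive Q K act
            \<longrightarrow> super_asymp_separately_nonexpansive Q K act)
       \<and> (\<forall>act :: 's \<Rightarrow> 'x \<Rightarrow> 'x.
            action_on K act \<and> separately_continuous_on K act
              \<and> asymp_uniformly_nonexpansive Q K act
            \<longrightarrow> super_asymp_uniformly_nonexpansive Q K act)"
proof -
  obtain L :: "'s set" where L: "left_ideal L" and least: "\<And>I. left_ideal I \<Longrightarrow> L \<subseteq> I"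
    using least_left_ideal_exists[OF assms(1,2)] by blast
  have mult: "s * t \<in> L" if "s \<in> L" for s t
    using L least that by (rule least_left_ideal_mult_right)
  show ?thesis
  proof (intro conjI allI impI; elim conjE)
    fix act :: "'s \<Rightarrow> 'x \<Rightarrow> 'x"
    assume "asymp_separately_nonexpansive Q K act"
    then have "q (act s x - act s y) \<le> q (x - y)"
      if "s \<in> L" "x \<in> K" "y \<in> K" "q \<in> Q" for s x y q
      using that least unfolding asymp_separately_nonexpansive_def by (meson subsetD)
    \<comment> \<open>The inequality is taken at \<open>s * t\<close>, which stays in
      \<open>L\<close>, and at the original points \<open>x\<close> and \<open>y\<close> rather than
      at their images under \<open>t\<close>.\<close>
    then show "super_asymp_separately_nonexpansive Q K act"
      unfolding super_asymp_separately_nonexpansive_def using L mult by blast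
  next
    fix act :: "'s \<Rightarrow> 'x \<Rightarrow> 'x"
    assume "asymp_uniformly_nonexpansive Q K act"
    then have "q (act s x - act s y) \<le> q (x - y)"
      if "s \<in> L" "x \<in> K" "y \<in> K" "q \<in> Q" for s x y q
      using that least unfolding asymp_uniformly_nonexpansive_def by (meson subsetD)
    then show "super_asymp_uniformly_nonexpansive Q K act"
      unfolding super_asymp_uniformly_nonexpansive_def using L mult by blast
  qed
qed

end
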